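(* If $G$ is a finite simple graph without isolated vertices, then $Z(G)\leq Z(L(G))$, where $Z$ denotes the zero forcing number and $L(G)$ the line graph of $G$.
   Context: All graphs are non-empty, simple, finite and undirected; $[k]=\{1,\ldots,k\}$. The zero forcing number $Z(G)$ of a graph $G$ with $n$ vertices is the minimum positive integer $k$ for which there are $k$ vertices $u_1,\ldots,u_k$ of $G$ and a linear order $u_{k+1},\ldots,u_n$ of the remaining vertices such that for every $j\in\{k+1,\ldots,n\}$ there is some $i\in[j-1]$ such that $u_j$ is the unique neighbor of $u_i$ in $G$ contained in $\{u_j,u_{j+1},\ldots,u_n\}$ (one says $u_i$ forces $u_j$). The line graph $L(G)$ has vertex set $E(G)$, two vertices being adjacent iff the corresponding edges of $G$ share an endpoint. *)

theory Defs
  imports "Graph_Theory.Pair_Digraph"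
begin

text \<open>
  A finite simple undirected graph is a \<^locale>\<open>pair_graph\<close>: a finite loop-free digraph with a
  symmetric arc relation, an undirected edge \<open>{u, v}\<close> being the pair of arcs \<open>(u, v)\<close>, \<open>(v, u)\<close>.
\<close>

definition neighbors :: "'a pair_pre_digraph \<Rightarrow> 'a \<Rightarrow> 'a set" where
  "neighbors G u = {v. (u, v) \<in> parcs G}"

definition edges :: "'a pair_pre_digraph \<Rightarrow> 'a set set" where
  "edges G = {{u, v} | u v. (u, v) \<in> parcs G}"

definition line_graph :: "'a pair_pre_digraph \<Rightarrow> 'a set pair_pre_digraph" where
  "line_graph G =
     \<lparr> pverts = edges G,
       parcs = {(e, f). e \<in> edges G \<and> f \<in> edges G \<and> e \<noteq> f \<and> e \<inter> f \<noteq> {}} \<rparr>"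

text \<open>
  The list \<open>us\<close> enumerates the vertices \<open>u\<^sub>1, \<dots>, u\<^sub>n\<close> with \<open>us ! i\<close> for \<open>u\<^bsub>i+1\<^esub>\<close>; the first \<open>k\<close>
  entries are the initial ones, and \<open>set (drop j us)\<close> is \<open>{u\<^bsub>j+1\<^esub>, \<dots>, u\<^sub>n}\<close>.
\<close>

definition forcing_order :: "'a pair_pre_digraph \<Rightarrow> nat \<Rightarrow> 'a list \<Rightarrow> bool" where
  "forcing_order G k us \<longleftrightarrow>
     distinct us \<and> set us = pverts G \<and> k \<le> length us \<and>
     (\<forall>j. k \<le> j \<and> j < length us \<longrightarrow>
        (\<exists>i<j. neighbors G (us ! i) \<inter> set (drop j us) = {us ! j}))"

definition zero_forcing_number :: "'a pair_pre_digraph \<Rightarrow> nat" where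
  "zero_forcing_number G = (LEAST k. 0 < k \<and> (\<exists>us. forcing_order G k us))"

lemma edges_finite:
  assumes "pair_graph G"
  shows "finite (edges G)"
proof -
  interpret pair_graph G by fact
  have "edges G = (\<lambda>(u, v). {u, v}) ` parcs G"
    by (auto simp: edges_def)
  then show ?thesis by simp
qed

lemma pair_graph_line_graph:
  assumes "pair_graph G"
  shows "pair_graph (line_graph G)"
proof -
  have fin: "finite (edges G)" using assms by (rule edges_finite)
  have "finite {(e, f). e \<in> edges G \<and> f \<in> edges G \<and> e \<noteq> f \<and> e \<inter> f \<noteq> {}}"
    by (rule finite_subset[of _ "edges G \<times> edges G"]) (auto simp: fin)
  then show ?thesis
    using fin
    by unfold_locales
      (auto simp: line_graph_def symmetric_def arcs_ends_def arc_to_ends_def intro!: symI)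
qed

text \<open>The minimum defining \<^const>\<open>zero_forcing_number\<close> is attained on every non-empty finite graph.\<close>

lemma zero_forcing_number_attained:
  assumes "pair_graph G" "pverts G \<noteq> {}"
  shows "0 < zero_forcing_number G" "\<exists>us. forcing_order G (zero_forcing_number G) us"
proof -
  interpret pair_graph G by fact
  obtain us where us: "set us = pverts G" "distinct us"
    using finite_distinct_list[of "pverts G"] by auto
  then have "0 < length us \<and> (\<exists>us'. forcing_order G (length us) us')"
    using assms(2) by (auto simp: forcing_order_def)
  from LeastI[of "\<lambda>k. 0 < k \<and> (\<exists>us. forcing_order G k us)", OF this]
  show "0 < zero_forcing_number G" "\<exists>us. forcing_order G (zero_forcing_number G) us"
    by (simp_all add: zero_forcing_number_def)
qed

end

theory Submission
  imports Defs
begin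

text \<open>
  Let \<open>B\<close> be the set of edges that are coloured at some stage of a forcing process on the line
  graph. By backward induction over the process, some transversal \<open>T\<close> of the connected components
  of the spanning subgraph \<open>(V, B)\<close> has the property that \<open>V - T\<close> forces \<open>G\<close>. If all edges are
  coloured, every transversal works: any neighbour of \<open>t \<in> T\<close> forces \<open>t\<close>. If the edge \<open>uv\<close> forces
  the edge \<open>vw\<close>, choose \<open>v\<close> as the representative of its component before the force, and \<open>w\<close> as that
  of its own component if this is a different one: then \<open>u\<close> forces \<open>v\<close>, and \<open>v\<close> forces \<open>w\<close>. For the
  initial set \<open>B\<close> of \<open>k\<close> edges there are at least \<open>|V| - k\<close> components, so \<open>|V - T| \<le> k\<close>.
\<close>

section \<open>Connectivity in the spanning subgraph of an edge set\<close>

definition conn :: "'a set set \<Rightarrow> ('a \<times> 'a) set" where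
  "conn B = {(x, y). {x, y} \<in> B}\<^sup>*"

lemma conn_refl [simp]: "(x, x) \<in> conn B"
  by (simp add: conn_def)

lemma conn_sym: "(x, y) \<in> conn B \<Longrightarrow> (y, x) \<in> conn B"
proof -
  have "sym {(x, y). {x, y} \<in> B}"
    by (auto simp: sym_def insert_commute)
  then show "(x, y) \<in> conn B \<Longrightarrow> (y, x) \<in> conn B"
    unfolding conn_def by (meson sym_rtrancl symD)
qed

lemma conn_trans: "(x, y) \<in> conn B \<Longrightarrow> (y, z) \<in> conn B \<Longrightarrow> (x, z) \<in> conn B"
  unfolding conn_def by (rule rtrancl_trans)

lemma conn_edge: "{x, y} \<in> B \<Longrightarrow> (x, y) \<in> conn B"
  by (auto simp: conn_def)

lemma conn_mono: "A \<subseteq> B \<Longrightarrow> (x, y) \<in> conn A \<Longrightarrow> (x, y) \<in> conn B"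
  unfolding conn_def by (rule subsetD[OF rtrancl_mono]) auto

text \<open>A walk needs the new edge at most once: a second crossing leads only to an endpoint that
  at most one crossing already reaches.\<close>

lemma conn_insertD:
  assumes "(x, y) \<in> conn (insert {a, b} B)"
  shows "(x, y) \<in> conn B \<or> (x, a) \<in> conn B \<and> (b, y) \<in> conn B
    \<or> (x, b) \<in> conn B \<and> (a, y) \<in> conn B"
  using assms unfolding conn_def[of "insert {a, b} B"]
proof (induction rule: rtrancl_induct)
  case base
  show ?case by simp
next
  case (step y z)
  then consider "{y, z} \<in> B" | "y = a" "z = b" | "y = b" "z = a"
    by (auto simp: doubleton_eq_iff)
  then show ?case
  proof cases
    case 1
    then show ?thesis using step.IH conn_edge conn_trans by metis
  qed (use step.IH conn_refl in metis)+
qed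

section \<open>Transversals of the components\<close>

definition transversal :: "'a set \<Rightarrow> 'a set set \<Rightarrow> 'a set \<Rightarrow> bool" where
  "transversal V B T \<longleftrightarrow> T \<subseteq> V \<and> (\<forall>x\<in>V. \<exists>t\<in>T. (x, t) \<in> conn B) \<and>
     (\<forall>s\<in>T. \<forall>t\<in>T. (s, t) \<in> conn B \<longrightarrow> s = t)"

lemma transversal_exists: "\<exists>T. transversal V B T"
proof -
  define r where "r x = (SOME y. y \<in> V \<and> (x, y) \<in> conn B)" for x
  have r: "r x \<in> V \<and> (x, r x) \<in> conn B" if "x \<in> V" for x
    unfolding r_def by (rule someI[of _ x]) (simp add: that)
  have r_eq: "r x = r y" if "(x, y) \<in> conn B" for x y
  proof -
    \<comment> \<open>The predicate under \<open>SOME\<close> depends only on the component, hence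
      so does the chosen representative.\<close>
    have "(\<lambda>z. z \<in> V \<and> (x, z) \<in> conn B) = (\<lambda>z. z \<in> V \<and> (y, z) \<in> conn B)"
      using that conn_sym conn_trans by metis
    then show ?thesis by (simp add: r_def)
  qed
  have "s = t" if "s \<in> r ` V" "t \<in> r ` V" "(s, t) \<in> conn B" for s t
    using that r r_eq by (metis imageE)
  then have "transversal V B (r ` V)"
    using r by (auto simp: transversal_def)
  then show ?thesis by blast
qed

text \<open>Removing an edge splits at most one component, so adding one endpoint to
  \<open>T\<close> restores domination. Mere domination is assumed because the enlarged set may fail
  to be a transversal.\<close>

lemma card_le_card_edges_plus_card_dominating:
  assumes "finite B" "\<And>e. e \<in> B \<Longrightarrow> \<exists>a\<in>V. \<exists>b\<in>V. e = {a, b}" "finite T" "T \<subseteq> V"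
    and "\<And>x. x \<in> V \<Longrightarrow> \<exists>t\<in>T. (x, t) \<in> conn B"
  shows "card V \<le> card B + card T"
  using assms
proof (induction B arbitrary: T rule: finite_induct)
  case empty
  have "V \<subseteq> T"
    using empty.prems(4) by (force simp: conn_def)
  then show ?case
    using empty.prems(2) by (simp add: card_mono)
next
  case (insert e B)
  obtain a' b' where ab': "a' \<in> V" "b' \<in> V" "e = {a', b'}"
    using insert.prems(1) by blast
  obtain t where t: "t \<in> T" "(a', t) \<in> conn (insert {a', b'} B)"
    using insert.prems(4) ab' by blast
  \<comment> \<open>The endpoints are named so that \<open>a\<close> still reaches \<open>t\<close>
    without the edge; only vertices on the side of \<open>b\<close> can be cut off from
    \<open>T\<close>.\<close>
  obtain a b where ab: "a \<in> V" "b \<in> V" "e = {a, b}" "(a, t) \<in> conn B"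
  proof (cases "(a', t) \<in> conn B")
    case True
    with ab' show ?thesis by (intro that[of a' b'])
  next
    case False
    then have "(b', t) \<in> conn B"
      using conn_insertD[OF t(2)] by blast
    with ab' show ?thesis by (intro that[of b' a']) auto
  qed
  have "\<exists>s\<in>insert b T. (x, s) \<in> conn B" if x: "x \<in> V" for x
  proof -
    obtain s where "s \<in> T" "(x, s) \<in> conn (insert {a, b} B)"
      using insert.prems(4)[OF x] ab(3) by blast
    then show ?thesis
      using conn_insertD[of x s a b B] ab(4) t(1) conn_trans[of x a B t] by blast
  qed
  then have "card V \<le> card B + card (insert b T)"
    using insert.prems ab(2) by (intro insert.IH) auto
  also have "\<dots> \<le> card (insert e B) + card T"
    using insert.hyps insert.prems(2) by (simp add: card_insert_if)
  finally show ?case .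
qed

text \<open>Only the component of the deleted edge changes, and it can be represented anew by
  \<open>v\<close>, together with \<open>w\<close> if it falls apart. The last inclusion leaves just
  \<open>v\<close> and \<open>w\<close> to be forced before the complement of \<open>T'\<close> is
  covered.\<close>

lemma transversal_delete_edge:
  assumes T': "transversal V (insert {v, w} B) T'" and "v \<in> V" "w \<in> V"
  obtains T where "transversal V B T" "v \<in> T" "T \<subseteq> T' \<union> {v, w}"
proof
  let ?B' = "insert {v, w} B"
  define T where "T = {t \<in> T'. (t, v) \<notin> conn ?B'} \<union> {v} \<union> (if (v, w) \<in> conn B then {} else {w})"
  show "v \<in> T" "T \<subseteq> T' \<union> {v, w}"
    by (auto simp: T_def)
  have up: "(x, y) \<in> conn ?B'" if "(x, y) \<in> conn B" for x y
    using that conn_mono[of B ?B'] by blast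
  have wv: "(w, v) \<in> conn ?B'"
    by (rule conn_sym, rule conn_edge) simp
  have "\<exists>t\<in>T. (x, t) \<in> conn B" if x: "x \<in> V" for x
  proof -
    \<comment> \<open>A vertex attached to \<open>w\<close> is represented by \<open>w\<close>
      itself after a split, and by \<open>v\<close> otherwise.\<close>
    have dom: "\<exists>t\<in>T. (x, t) \<in> conn B" if "(x, v) \<in> conn B \<or> (x, w) \<in> conn B"
      using that conn_sym[of v w B] conn_trans[of x w B v] by (auto simp: T_def)
    obtain t where t: "t \<in> T'" "(x, t) \<in> conn ?B'"
      using T' x by (auto simp: transversal_def)
    show ?thesis
    proof (cases "(t, v) \<in> conn ?B'")
      case True
      then have "(x, v) \<in> conn ?B'"
        using conn_trans[OF t(2)] by blast
      from conn_insertD[OF this] show ?thesis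
        using dom by blast
    next
      case False
      then have "t \<in> T" using t by (simp add: T_def)
      then show ?thesis
        using conn_insertD[OF t(2)] dom by blast
    qed
  qed
  moreover have "s = t" if st: "s \<in> T" "t \<in> T" "(s, t) \<in> conn B" for s t
  proof -
    have in_T: "x \<in> T' \<and> (x, v) \<notin> conn ?B' \<or> x = v \<or> x = w \<and> (v, w) \<notin> conn B" if "x \<in> T" for x
      using that by (auto simp: T_def split: if_splits)
    have near: "(x, v) \<in> conn ?B'" if "(x, y) \<in> conn B" "y = v \<or> y = w" for x y
      using that up wv conn_trans by metis
    have "(t, s) \<in> conn B" using st(3) by (rule conn_sym)
    then show ?thesis
      using in_T[OF st(1)] in_T[OF st(2)] st(3) near up T'
      unfolding transversal_def by metis
  qed
  moreover have "T \<subseteq> V"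
    using T' assms(2,3) by (auto simp: T_def transversal_def)
  ultimately show "transversal V B T"
    by (auto simp: transversal_def)
qed

section \<open>Zero forcing sets without an order\<close>

definition stalled :: "'a pair_pre_digraph \<Rightarrow> 'a set \<Rightarrow> bool" where
  "stalled G X \<longleftrightarrow> (\<forall>u\<in>X. \<forall>v. neighbors G u - X \<noteq> {v})"

text \<open>Order-free substitute for \<open>forcing_order\<close>: instead of building lists, one
  shows that a stalled set above \<open>S\<close> must be everything.\<close>

definition zero_forcing_set :: "'a pair_pre_digraph \<Rightarrow> 'a set \<Rightarrow> bool" where
  "zero_forcing_set G S \<longleftrightarrow>
     S \<subseteq> pverts G \<and> (\<forall>X. S \<subseteq> X \<and> X \<subseteq> pverts G \<and> stalled G X \<longrightarrow> X = pverts G)"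

text \<open>The list grows greedily: while vertices are missing, \<open>set us\<close> is not
  stalled, so some vertex can be forced and appended. Uncoloured vertices are expressed as the
  complement of a prefix, since a suffix of an unfinished list would not contain all of
  them.\<close>

lemma forcing_order_extend:
  assumes G: "pair_graph G" and S: "zero_forcing_set G S"
    and "distinct us" "S \<subseteq> set us" "set us \<subseteq> pverts G" "k \<le> length us"
    and "\<And>j. k \<le> j \<Longrightarrow> j < length us \<Longrightarrow> \<exists>i<j. neighbors G (us ! i) - set (take j us) = {us ! j}"
  shows "\<exists>vs. forcing_order G k vs"
  using assms(3-)
proof (induction "card (pverts G - set us)" arbitrary: us rule: less_induct)
  case less
  interpret pair_graph G by fact
  have nb: "neighbors G u \<subseteq> pverts G" for u
    using wellformed' by (auto simp: neighbors_def)
  show ?case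
  proof (cases "set us = pverts G")
    case True
    have "neighbors G u \<inter> set (drop j us) = neighbors G u - set (take j us)" for u j
    proof -
      have "set (take j us) \<union> set (drop j us) = pverts G"
        using True by (metis append_take_drop_id set_append)
      moreover have "set (take j us) \<inter> set (drop j us) = {}"
        using less.prems(1) by (simp add: set_take_disj_set_drop_if_distinct)
      ultimately show ?thesis using nb[of u] by blast
    qed
    then have "forcing_order G k us"
      using less.prems True by (simp add: forcing_order_def)
    then show ?thesis ..
  next
    case False
    then obtain u v where u: "u \<in> set us" and v: "neighbors G u - set us = {v}"
      using S less.prems(2,3) unfolding zero_forcing_set_def stalled_def by blast
    then have v': "v \<in> pverts G" "v \<notin> set us" using nb by auto
    show ?thesis
    proof (rule less.hyps[of "us @ [v]"])
      show "card (pverts G - set (us @ [v])) < card (pverts G - set us)"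
        using v' by (intro psubset_card_mono) auto
      fix j assume j: "k \<le> j" "j < length (us @ [v])"
      show "\<exists>i<j. neighbors G ((us @ [v]) ! i) - set (take j (us @ [v])) = {(us @ [v]) ! j}"
      proof (cases "j < length us")
        case True
        then show ?thesis
          using less.prems(5)[OF j(1) True] by (auto simp: nth_append)
      next
        case False
        with j have "j = length us" by simp
        then show ?thesis using u v by (auto simp: nth_append in_set_conv_nth)
      qed
    qed (use less.prems v' in auto)
  qed
qed

lemma zero_forcing_number_le_card:
  assumes G: "pair_graph G" and "pverts G \<noteq> {}" and S: "zero_forcing_set G S"
  shows "zero_forcing_number G \<le> card S"
proof -
  interpret pair_graph G by fact
  have "S \<subseteq> pverts G" using S by (simp add: zero_forcing_set_def)
  then have fin: "finite S" by (rule finite_subset) simp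
  \<comment> \<open>The empty set is stalled vacuously, so \<open>S\<close> is nonempty, as the
    positivity in \<open>zero_forcing_number\<close> demands.\<close>
  have "S \<noteq> {}"
    using S assms(2) by (force simp: zero_forcing_set_def stalled_def)
  then have "0 < card S" using fin by (simp add: card_gt_0_iff)
  moreover obtain us where us: "set us = S" "distinct us"
    using finite_distinct_list[OF fin] by blast
  then have "length us = card S" by (metis distinct_card)
  \<comment> \<open>With \<open>k = length us\<close> no position of the list has to be justified
    yet.\<close>
  then have "\<exists>vs. forcing_order G (card S) vs"
    using us \<open>S \<subseteq> pverts G\<close> by (intro forcing_order_extend[OF G S, of us]) auto
  ultimately show ?thesis
    unfolding zero_forcing_number_def by (intro Least_le) blast
qed

section \<open>Transfer of forcing from the line graph\<close>

lemma doubleton_mem_edges_iff: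
  assumes "pair_graph G"
  shows "{u, v} \<in> edges G \<longleftrightarrow> (u, v) \<in> parcs G"
proof -
  interpret pair_graph G by fact
  show ?thesis
    using arcs_symmetric by (auto simp: edges_def doubleton_eq_iff)
qed

text \<open>All neighbours of a neighbour of \<open>t\<close> lie in the component whose sole
  representative is \<open>t\<close>, so none but \<open>t\<close> can be uncoloured.\<close>

lemma zero_forcing_set_compl_transversal_edges:
  assumes G: "pair_graph G" and iso: "\<forall>v \<in> pverts G. neighbors G v \<noteq> {}"
    and T: "transversal (pverts G) (edges G) T"
  shows "zero_forcing_set G (pverts G - T)"
proof -
  interpret pair_graph G by fact
  have False if X: "pverts G - T \<subseteq> X" "X \<subseteq> pverts G" "stalled G X" "t \<in> pverts G" "t \<notin> X" for X t
  proof -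
    have "t \<in> T" using X by blast
    obtain u where u: "(t, u) \<in> parcs G"
      using iso X(4) by (auto simp: neighbors_def)
    then have ut: "(u, t) \<in> parcs G" "u \<in> pverts G" "u \<noteq> t"
      using arcs_symmetric wellformed' no_loops' by auto
    have conn: "(x, y) \<in> conn (edges G)" if "(x, y) \<in> parcs G" for x y
      using that by (intro conn_edge) (simp add: doubleton_mem_edges_iff[OF G])
    have uniq: "x = t" if "x \<in> T" "(t, x) \<in> conn (edges G)" for x
      using T that \<open>t \<in> T\<close> unfolding transversal_def by blast
    have "u \<in> X"
      using uniq[of u] conn[OF u] ut X(1) by blast
    moreover have "neighbors G u - X = {t}"
    proof -
      have "x = t" if "(u, x) \<in> parcs G" "x \<notin> X" for x
      proof (rule uniq)
        show "x \<in> T" using that X(1) wellformed'(2)[OF that(1)] by auto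
        show "(t, x) \<in> conn (edges G)"
          using conn_trans[OF conn[OF u] conn[OF that(1)]] .
      qed
      then show ?thesis using ut X(5) unfolding neighbors_def by blast
    qed
    ultimately show False using X(3) by (auto simp: stalled_def)
  qed
  then show ?thesis unfolding zero_forcing_set_def by blast
qed

text \<open>Write \<open>f\<close> as \<open>uv\<close> and \<open>e\<close> as \<open>vw\<close>.
  Every edge meeting \<open>f\<close> lies in \<open>insert e B\<close>, so all neighbours of
  \<open>u\<close>, and those of \<open>v\<close> other than \<open>w\<close>, lie in the
  \<open>B\<close>-component of \<open>v\<close>, whose only initially uncoloured vertex is
  \<open>v\<close>.\<close>

lemma zero_forcing_set_compl_transversal_step:
  assumes G: "pair_graph G" and B: "B \<subseteq> edges G" and f: "f \<in> B"
    and force: "neighbors (line_graph G) f - B = {e}"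
    and T': "transversal (pverts G) (insert e B) T'" "zero_forcing_set G (pverts G - T')"
  obtains T where "transversal (pverts G) B T" "zero_forcing_set G (pverts G - T)"
proof -
  interpret pair_graph G by fact
  have e: "e \<in> edges G" "e \<noteq> f" "f \<inter> e \<noteq> {}" "e \<notin> B"
    using force by (auto simp: neighbors_def line_graph_def)
  have adj: "g \<in> insert e B" if "g \<in> edges G" "g \<inter> f \<noteq> {}" for g
    proof (cases "g = f")
    case False
    then have "g \<in> neighbors (line_graph G) f"
      using that f B by (auto simp: neighbors_def line_graph_def)
    then show ?thesis using force by blast
  qed (simp add: f)
  obtain v where v: "v \<in> f" "v \<in> e" using e(3) by blast
  obtain u where u: "f = {u, v}"
    using v(1) f B by (auto simp: edges_def)
  obtain w where w: "e = {v, w}"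
    using v(2) e(1) by (auto simp: edges_def)
  have uv: "(u, v) \<in> parcs G" and vw: "(v, w) \<in> parcs G"
    using f B e(1) u w doubleton_mem_edges_iff[OF G] by auto
  have ne: "u \<noteq> v" "v \<noteq> w" "u \<noteq> w"
    using uv vw no_loops' e(2) u w by auto
  have V: "u \<in> pverts G" "v \<in> pverts G" "w \<in> pverts G"
    using uv vw wellformed' by auto
  obtain T where T: "transversal (pverts G) B T" "v \<in> T" "T \<subseteq> T' \<union> {v, w}"
    using transversal_delete_edge T'(1) V(2,3) unfolding w by metis
  have uniq: "x = v" if "x \<in> T" "(v, x) \<in> conn B" for x
    using T(1,2) that unfolding transversal_def by blast
  have vu: "(v, u) \<in> conn B"
    using f u by (intro conn_sym[OF conn_edge]) simp
  have nb_u: "(v, x) \<in> conn B" if "(u, x) \<in> parcs G" for x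
  proof -
    have "{u, x} \<in> insert e B"
      using that doubleton_mem_edges_iff[OF G] u by (intro adj) auto
    then have "{u, x} \<in> B" using ne w by (auto simp: doubleton_eq_iff)
    then show ?thesis using conn_trans[OF vu conn_edge] by blast
  qed
  have nb_v: "(v, x) \<in> conn B" if "(v, x) \<in> parcs G" "x \<noteq> w" for x
  proof -
    have "{v, x} \<in> insert e B"
      using that doubleton_mem_edges_iff[OF G] u by (intro adj) auto
    then have "{v, x} \<in> B" using that w by (auto simp: doubleton_eq_iff)
    then show ?thesis by (rule conn_edge)
  qed
  have "X = pverts G" if X: "pverts G - T \<subseteq> X" "X \<subseteq> pverts G" "stalled G X" for X
  proof -
    have black: "x \<in> X" if "x \<in> pverts G" "(v, x) \<in> conn B" "x \<noteq> v" for x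
      using that uniq X(1) by blast
    have "v \<in> X"
    proof (rule ccontr)
      assume "v \<notin> X"
      moreover have "x = v" if "(u, x) \<in> parcs G" "x \<notin> X" for x
        using that black[of x] nb_u[of x] wellformed'(2)[OF that(1)] by auto
      ultimately have "neighbors G u - X = {v}"
        using uv unfolding neighbors_def by blast
      then show False
        using X(3) black[OF V(1) vu ne(1)] by (auto simp: stalled_def)
    qed
    moreover have "w \<in> X"
    proof (rule ccontr)
      assume "w \<notin> X"
      moreover have "x = w" if "(v, x) \<in> parcs G" "x \<notin> X" for x
        using that black[of x] nb_v[of x] wellformed'(2)[OF that(1)] \<open>v \<in> X\<close> by auto
      ultimately have "neighbors G v - X = {w}"
        using vw unfolding neighbors_def by blast
      then show False
        using X(3) \<open>v \<in> X\<close> by (auto simp: stalled_def)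
    qed
    \<comment> \<open>Once \<open>v\<close> and \<open>w\<close> are in \<open>X\<close>, the zero
      forcing set given by \<open>T'\<close> takes over.\<close>
    ultimately have "pverts G - T' \<subseteq> X"
      using T(3) X(1) by blast
    then show ?thesis
      using T'(2) X by (simp add: zero_forcing_set_def)
  qed
  then have "zero_forcing_set G (pverts G - T)"
    by (auto simp: zero_forcing_set_def)
  with T(1) show ?thesis by (rule that)
qed

theorem theorem2:
  fixes G :: "'a pair_pre_digraph"
  assumes "pair_graph G"
    and "pverts G \<noteq> {}"
    and "\<forall>v \<in> pverts G. neighbors G v \<noteq> {}"
  shows "zero_forcing_number G \<le> zero_forcing_number (line_graph G)"
proof -
  interpret pair_graph G by fact
  let ?L = "line_graph G"
  define k where "k = zero_forcing_number ?L"
  \<comment> \<open>Some vertex exists and none is isolated, so there is an edge; hence the minimum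
    for the line graph is attained.\<close>
  have "pverts ?L \<noteq> {}"
    using assms(2,3) by (auto simp: line_graph_def edges_def neighbors_def)
  then obtain es where "forcing_order ?L k es"
    using zero_forcing_number_attained(2)[OF pair_graph_line_graph[OF assms(1)]] k_def by blast
  then have es: "distinct es" "set es = edges G" "k \<le> length es"
    and force: "\<And>j. k \<le> j \<Longrightarrow> j < length es \<Longrightarrow>
      \<exists>i<j. neighbors ?L (es ! i) \<inter> set (drop j es) = {es ! j}"
    by (auto simp: forcing_order_def line_graph_def)
  have "\<exists>T. transversal (pverts G) (set (take k es)) T \<and> zero_forcing_set G (pverts G - T)"
    using es(3)
  \<comment> \<open>The induction runs downwards from \<open>length es\<close>, where all edges are
    coloured, to \<open>k\<close>.\<close>
  proof (induction rule: inc_induct)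
    case base
    then show ?case
      using transversal_exists[of "pverts G" "edges G"] es(2)
        zero_forcing_set_compl_transversal_edges[OF assms(1,3)] by auto
  next
    case (step j)
    let ?B = "set (take j es)"
    have B: "?B \<subseteq> edges G"
      using es(2) set_take_subset by metis
    obtain i where i: "i < j" "neighbors ?L (es ! i) \<inter> set (drop j es) = {es ! j}"
      using force step.hyps by blast
    have f: "es ! i \<in> ?B"
      using i(1) step.hyps by (auto simp: in_set_conv_nth)
    \<comment> \<open>The suffix from \<open>j\<close> is the complement of \<open>?B\<close> among
      the edges, which turns the list condition into the set form needed for the step.\<close>
    have "edges G = ?B \<union> set (drop j es)"
      using es(2) by (metis append_take_drop_id set_append)
    moreover have "?B \<inter> set (drop j es) = {}"
      using es(1) by (simp add: set_take_disj_set_drop_if_distinct)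
    moreover have "neighbors ?L (es ! i) \<subseteq> edges G"
      by (auto simp: neighbors_def line_graph_def)
    ultimately have "neighbors ?L (es ! i) - ?B = {es ! j}"
      using i(2) by blast
    moreover have "set (take (Suc j) es) = insert (es ! j) ?B"
      using step.hyps by (simp add: take_Suc_conv_app_nth)
    ultimately show ?case
      using step.IH zero_forcing_set_compl_transversal_step[OF assms(1) B f] by metis
  qed
  then obtain T where T: "transversal (pverts G) (set (take k es)) T"
    and S: "zero_forcing_set G (pverts G - T)" by blast
  have TV: "T \<subseteq> pverts G" "finite T"
    using T finite_subset[of T "pverts G"] by (auto simp: transversal_def)
  have "card (pverts G) \<le> card (set (take k es)) + card T"
  proof (rule card_le_card_edges_plus_card_dominating)
    fix e assume "e \<in> set (take k es)"
    then have "e \<in> edges G"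
      using es(2) in_set_takeD by metis
    then show "\<exists>a\<in>pverts G. \<exists>b\<in>pverts G. e = {a, b}"
      using wellformed' unfolding edges_def by blast
  qed (use T TV in \<open>auto simp: transversal_def\<close>)
  moreover have "card (set (take k es)) = k"
    using es by (simp add: distinct_card)
  ultimately have "card (pverts G - T) \<le> k"
    using TV by (simp add: card_Diff_subset)
  then show ?thesis
    using zero_forcing_number_le_card[OF assms(1,2) S] by (simp add: k_def)
qed

end
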